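(* Let $n, m$ be positive integers, let $a, c \in \mathbb{Z}_n$ and $b, d \in \mathbb{Z}_m$. The additive subgroup of $\mathbb{Z}_n\times\mathbb{Z}_m$ generated by $(a,b)$ and $(c,d)$ is an ideal of the ring $\mathbb{Z}_n\times\mathbb{Z}_m$ if and only if \[(\ker \phi_{a,c})(\ker \phi_{b,d}) = \mathbb{Z}\times\mathbb{Z}.\]
   Context: $\mathbb{Z}_N$ is the ring of integers modulo $N$; product rings have componentwise operations. The map $\phi_{a,c}\colon \mathbb{Z}\times\mathbb{Z}\to\mathbb{Z}_n$ is the additive homomorphism $\phi_{a,c}(x,y) = ax+cy$, and $\phi_{b,d}\colon\mathbb{Z}\times\mathbb{Z}\to\mathbb{Z}_m$ is $\phi_{b,d}(x,y)=bx+dy$. For subgroups $H,K$ of an (additive) abelian group, $HK$ denotes the subgroup $\{h+k : h\in H, k\in K\}$. *)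

theory Defs
  imports "HOL-Algebra.Algebra"
begin

text \<open>
  The ring of integers modulo \<open>n\<close> is rendered as the quotient ring \<open>ZFact n\<close>, whose
  elements are cosets; unlike \<open>residue_ring n\<close>, it is a ring also for \<open>n = 1\<close>.
\<close>

abbreviation ZxZ :: "(int \<times> int) ring"
  where "ZxZ \<equiv> RDirProd \<Z> \<Z>"

text \<open>
  \<open>phi R a c\<close> is the map $\phi_{a,c}(x,y) = ax + cy$ into \<open>R\<close>. Since \<open>x\<close> and \<open>y\<close> are integers
  while \<open>a\<close> and \<open>c\<close> lie in \<open>R\<close>, the products are integer multiples in the additive group of \<open>R\<close>.
\<close>

definition phi :: "('a, 'm) ring_scheme \<Rightarrow> 'a \<Rightarrow> 'a \<Rightarrow> int \<times> int \<Rightarrow> 'a"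
  where "phi R a c = (\<lambda>(x, y). [x] \<cdot>\<^bsub>R\<^esub> a \<oplus>\<^bsub>R\<^esub> [y] \<cdot>\<^bsub>R\<^esub> c)"

lemma phi_hom:
  assumes "abelian_group R" and "a \<in> carrier R" and "c \<in> carrier R"
  shows "phi R a c \<in> hom (add_monoid ZxZ) (add_monoid R)"
proof -
  interpret abelian_group R by fact
  show ?thesis
    using assms(2,3)
    by (intro homI)
       (auto simp: phi_def RDirProd_def DirProd_def monoid.defs add.int_pow_mult a_ac)
qed

end

theory Submission
  imports Defs
begin

text \<open>
  Let \<open>f = \<phi>\<^sub>a\<^sub>,\<^sub>c\<close> and \<open>g = \<phi>\<^sub>b\<^sub>,\<^sub>d\<close>. The subgroup generated by \<open>(a, b)\<close> and \<open>(c, d)\<close> is the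
  set of all \<open>(f p, g p)\<close> with \<open>p\<close> in \<open>\<int> \<times> \<int>\<close>. Every element of \<open>\<int>\<^sub>n\<close> or \<open>\<int>\<^sub>m\<close> is an integer
  multiple of \<open>\<one>\<close>, so multiplying \<open>(f p, g p)\<close> by a ring element gives \<open>(s \<cdot> f p, t \<cdot> g p)\<close>
  with integers \<open>s\<close> and \<open>t\<close>, and what prevents the subgroup from being an ideal is
  that \<open>s\<close> and \<open>t\<close> are chosen independently.

  If the subgroup is an ideal, then \<open>(\<one>, \<zero>) \<otimes> (f p, g p) = (f p, \<zero>)\<close> lies in it, say as
  \<open>(f q, g q)\<close>; then \<open>p = (p - q) + q\<close> with \<open>p - q \<in> ker f\<close> and \<open>q \<in> ker g\<close>. Conversely, if
  \<open>p = k + l\<close> with \<open>f k = \<zero>\<close> and \<open>g l = \<zero>\<close>, then \<open>(f p, g p) = (f l, g k)\<close>, where the two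
  components can be scaled independently: \<open>(s \<cdot> f l, t \<cdot> g k)\<close> is the image of
  \<open>t \<cdot> k + s \<cdot> l\<close>. The lemma \<open>ideal_pair_image_iff\<close> gives this argument for maps
  \<open>f\<close>, \<open>g\<close> from an arbitrary abelian group; \<open>generate_pair_eq_image_phi\<close> and \<open>phi_RDirProd\<close>
  identify the generated subgroup with the image of \<open>p \<mapsto> (f p, g p)\<close>.
\<close>

text \<open>
  Up to isomorphism, these are exactly the quotient rings of \<open>\<int>\<close>.
\<close>

definition one_generated :: "('a, 'm) ring_scheme \<Rightarrow> bool"
  where "one_generated R \<longleftrightarrow> (\<forall>r \<in> carrier R. \<exists>k::int. r = [k] \<cdot>\<^bsub>R\<^esub> \<one>\<^bsub>R\<^esub>)"

text \<open>
  This turns the multiplicative closure condition for ideals into one on integer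
  multiples, which additive homomorphisms respect.
\<close>

lemma one_generated_mult:
  assumes "ring R" and "one_generated R" and "r \<in> carrier R"
  obtains k :: int
  where "\<And>x. x \<in> carrier R \<Longrightarrow> r \<otimes>\<^bsub>R\<^esub> x = [k] \<cdot>\<^bsub>R\<^esub> x"
    and "\<And>x. x \<in> carrier R \<Longrightarrow> x \<otimes>\<^bsub>R\<^esub> r = [k] \<cdot>\<^bsub>R\<^esub> x"
proof -
  interpret ring R by fact
  obtain k :: int where "r = [k] \<cdot>\<^bsub>R\<^esub> \<one>\<^bsub>R\<^esub>"
    using assms(2,3) unfolding one_generated_def by blast
  then show thesis
    by (intro that[of k]) (simp_all add: add_pow_ldistr_int add_pow_rdistr_int)
qed

lemma int_ring_add_pow_one: "[k] \<cdot>\<^bsub>\<Z>\<^esub> (1::int) = k"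
proof -
  have nat: "[j] \<cdot>\<^bsub>\<Z>\<^esub> (1::int) = int j" for j :: nat
    by (induction j) (simp_all add: add_pow_def)
  have ge: "[i] \<cdot>\<^bsub>\<Z>\<^esub> (1::int) = i" if "i \<ge> 0" for i :: int
    using that nat[of "nat i"] by (simp add: add_pow_int_ge)
  show ?thesis
    using ge[of k] ge[of "- k"] int.add.int_pow_neg[of 1 "- k"] by (cases "k \<ge> 0") simp_all
qed

lemma one_generated_ZFact: "one_generated (ZFact k)"
  unfolding one_generated_def
proof
  fix r assume r: "r \<in> carrier (ZFact k)"
  interpret I: ideal "Idl\<^bsub>\<Z>\<^esub> {k}" \<Z>
    by (simp add: int.genideal_ideal)
  interpret h: ring_hom_ring \<Z> "ZFact k" "(+>\<^bsub>\<Z>\<^esub>) (Idl\<^bsub>\<Z>\<^esub> {k})"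
    unfolding ZFact_def by (rule I.rcos_ring_hom_ring)
  interpret gh: group_hom "add_monoid \<Z>" "add_monoid (ZFact k)" "(+>\<^bsub>\<Z>\<^esub>) (Idl\<^bsub>\<Z>\<^esub> {k})"
    by (rule abelian_group_hom.a_group_hom) (rule h.abelian_group_hom_axioms)
  obtain j where j: "r = (Idl\<^bsub>\<Z>\<^esub> {k}) +>\<^bsub>\<Z>\<^esub> j"
    using r unfolding ZFact_defs A_RCOSETS_def' by auto
  have "r = (Idl\<^bsub>\<Z>\<^esub> {k}) +>\<^bsub>\<Z>\<^esub> ([j] \<cdot>\<^bsub>\<Z>\<^esub> (1::int))"
    by (simp add: int_ring_add_pow_one j)
  also have "\<dots> = [j] \<cdot>\<^bsub>ZFact k\<^esub> \<one>\<^bsub>ZFact k\<^esub>"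
    using gh.hom_int_pow[of 1 j] h.hom_one by (simp add: add_pow_def)
  finally show "\<exists>j::int. r = [j] \<cdot>\<^bsub>ZFact k\<^esub> \<one>\<^bsub>ZFact k\<^esub>" ..
qed

lemma RDirProd_add: "(x, y) \<oplus>\<^bsub>RDirProd R S\<^esub> (x', y') = (x \<oplus>\<^bsub>R\<^esub> x', y \<oplus>\<^bsub>S\<^esub> y')"
  and RDirProd_mult: "(x, y) \<otimes>\<^bsub>RDirProd R S\<^esub> (x', y') = (x \<otimes>\<^bsub>R\<^esub> x', y \<otimes>\<^bsub>S\<^esub> y')"
  by (simp_all add: RDirProd_def DirProd_def monoid.defs)

text \<open>
  The two kernels measure how far the components of \<open>(f p, g p)\<close> can be varied
  separately: adding elements of \<open>ker f\<close> to \<open>p\<close> moves only the second component, adding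
  elements of \<open>ker g\<close> only the first. Being an ideal is the same separation of the
  components, because it amounts to containing \<open>(f p, \<zero>)\<close> and \<open>(\<zero>, g p)\<close> for every \<open>p\<close>.
\<close>

theorem ideal_pair_image_iff:
  assumes "comm_group G" and R: "ring R" "one_generated R" and S: "ring S" "one_generated S"
    and f: "f \<in> hom G (add_monoid R)" and g: "g \<in> hom G (add_monoid S)"
  shows "ideal ((\<lambda>p. (f p, g p)) ` carrier G) (RDirProd R S)
     \<longleftrightarrow> kernel G (add_monoid R) f <#>\<^bsub>G\<^esub> kernel G (add_monoid S) g = carrier G"
    (is "ideal ?I ?P \<longleftrightarrow> ?F <#>\<^bsub>G\<^esub> ?K = _")
proof -
  interpret comm_group G by fact
  interpret R: ring R by fact
  interpret S: ring S by fact
  interpret P: ring ?P by (rule RDirProd_ring[OF R(1) S(1)])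
  interpret f: group_hom G "add_monoid R" f
    by unfold_locales (rule f)
  interpret g: group_hom G "add_monoid S" g
    by unfold_locales (rule g)
  have h: "(\<lambda>p. (f p, g p)) \<in> hom G (add_monoid ?P)"
    using f.hom_closed g.hom_closed f.hom_mult g.hom_mult by (auto simp: hom_def RDirProd_carrier RDirProd_add)
  interpret h: group_hom G "add_monoid ?P" "\<lambda>p. (f p, g p)"
    by unfold_locales (rule h)
  have fc [simp]: "f p \<in> carrier R" and gc [simp]: "g p \<in> carrier S" if "p \<in> carrier G" for p
    using that f.hom_closed g.hom_closed by simp_all
  have fmult: "f (p \<otimes>\<^bsub>G\<^esub> q) = f p \<oplus>\<^bsub>R\<^esub> f q" and gmult: "g (p \<otimes>\<^bsub>G\<^esub> q) = g p \<oplus>\<^bsub>S\<^esub> g q"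
    if "p \<in> carrier G" "q \<in> carrier G" for p q
    using f.hom_mult[OF that] g.hom_mult[OF that] by simp_all
  have fpow: "f (p [^]\<^bsub>G\<^esub> i) = [i] \<cdot>\<^bsub>R\<^esub> f p" and gpow: "g (p [^]\<^bsub>G\<^esub> i) = [i] \<cdot>\<^bsub>S\<^esub> g p"
    if "p \<in> carrier G" for p and i :: int
    using f.hom_int_pow[OF that, of i] g.hom_int_pow[OF that, of i] by (simp_all add: add_pow_def)
  have F: "k \<in> ?F \<longleftrightarrow> k \<in> carrier G \<and> f k = \<zero>\<^bsub>R\<^esub>" and K: "k \<in> ?K \<longleftrightarrow> k \<in> carrier G \<and> g k = \<zero>\<^bsub>S\<^esub>" for k
    by (simp_all add: kernel_def)
  show ?thesis
  proof
    assume "ideal ?I ?P"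
    then interpret I: ideal ?I ?P .
    have "p \<in> ?F <#>\<^bsub>G\<^esub> ?K" if p: "p \<in> carrier G" for p
    proof -
      \<comment> \<open>The idempotent \<open>(\<one>, \<zero>)\<close> separates the two components.\<close>
      have "(\<one>\<^bsub>R\<^esub>, \<zero>\<^bsub>S\<^esub>) \<otimes>\<^bsub>?P\<^esub> (f p, g p) \<in> ?I"
        using p by (intro I.I_l_closed) (auto simp: RDirProd_carrier)
      then obtain q where q: "q \<in> carrier G" "f q = f p" "g q = \<zero>\<^bsub>S\<^esub>"
        using p by (auto simp: RDirProd_mult)
      have "f (p \<otimes>\<^bsub>G\<^esub> inv\<^bsub>G\<^esub> q) = \<zero>\<^bsub>R\<^esub>"
        using p q f.hom_mult[of p "inv\<^bsub>G\<^esub> q"] f.hom_inv[of q] R.add.r_inv[of "f p"] by simp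
      then have "p \<otimes>\<^bsub>G\<^esub> inv\<^bsub>G\<^esub> q \<in> ?F" and "q \<in> ?K"
        using p q by (simp_all add: F K)
      moreover have "p = (p \<otimes>\<^bsub>G\<^esub> inv\<^bsub>G\<^esub> q) \<otimes>\<^bsub>G\<^esub> q"
        using p q by (simp add: m_assoc)
      ultimately show ?thesis
        unfolding set_mult_def by blast
    qed
    then show "?F <#>\<^bsub>G\<^esub> ?K = carrier G"
      by (auto simp: set_mult_def F K)
  next
    assume FK: "?F <#>\<^bsub>G\<^esub> ?K = carrier G"
    have scale: "([i] \<cdot>\<^bsub>R\<^esub> f p, [j] \<cdot>\<^bsub>S\<^esub> g p) \<in> ?I" if "p \<in> carrier G" for p and i j :: int
    proof -
      have "p \<in> ?F <#>\<^bsub>G\<^esub> ?K"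
        using that FK by simp
      then obtain k l where k: "k \<in> carrier G" "f k = \<zero>\<^bsub>R\<^esub>" and l: "l \<in> carrier G" "g l = \<zero>\<^bsub>S\<^esub>"
        and p: "p = k \<otimes>\<^bsub>G\<^esub> l"
        unfolding set_mult_def by (auto simp: F K)
      \<comment> \<open>The first component of \<open>(f p, g p)\<close> comes from \<open>l\<close> alone and the second from \<open>k\<close>
        alone, so the two exponents are free.\<close>
      have "f ((k [^]\<^bsub>G\<^esub> j) \<otimes>\<^bsub>G\<^esub> (l [^]\<^bsub>G\<^esub> i)) = [i] \<cdot>\<^bsub>R\<^esub> f p"
        using k l by (simp add: p fmult fpow R.add.int_pow_one)
      moreover have "g ((k [^]\<^bsub>G\<^esub> j) \<otimes>\<^bsub>G\<^esub> (l [^]\<^bsub>G\<^esub> i)) = [j] \<cdot>\<^bsub>S\<^esub> g p"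
        using k l by (simp add: p gmult gpow S.add.int_pow_one)
      ultimately show ?thesis
        using k l by (intro image_eqI[of _ _ "(k [^]\<^bsub>G\<^esub> j) \<otimes>\<^bsub>G\<^esub> (l [^]\<^bsub>G\<^esub> i)"]) simp_all
    qed
    show "ideal ?I ?P"
    proof (rule idealI)
      show "ring ?P" ..
      show "subgroup ?I (add_monoid ?P)"
        by (rule h.img_is_subgroup)
    next
      fix u x assume u: "u \<in> ?I" and x: "x \<in> carrier ?P"
      obtain p where p: "p \<in> carrier G" "u = (f p, g p)"
        using u by blast
      obtain r s where rs: "r \<in> carrier R" "s \<in> carrier S" "x = (r, s)"
        using x by (auto simp: RDirProd_carrier)
      obtain i j :: int
        where i: "\<And>y. y \<in> carrier R \<Longrightarrow> r \<otimes>\<^bsub>R\<^esub> y = [i] \<cdot>\<^bsub>R\<^esub> y" "\<And>y. y \<in> carrier R \<Longrightarrow> y \<otimes>\<^bsub>R\<^esub> r = [i] \<cdot>\<^bsub>R\<^esub> y"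
          and j: "\<And>y. y \<in> carrier S \<Longrightarrow> s \<otimes>\<^bsub>S\<^esub> y = [j] \<cdot>\<^bsub>S\<^esub> y" "\<And>y. y \<in> carrier S \<Longrightarrow> y \<otimes>\<^bsub>S\<^esub> s = [j] \<cdot>\<^bsub>S\<^esub> y"
        using one_generated_mult[OF R rs(1)] one_generated_mult[OF S rs(2)] by metis
      show "x \<otimes>\<^bsub>?P\<^esub> u \<in> ?I" and "u \<otimes>\<^bsub>?P\<^esub> x \<in> ?I"
        using scale[OF p(1), of i j] p(1) unfolding p(2) rs(3) RDirProd_mult by (simp_all add: i j)
    qed
  qed
qed

lemma generate_pair_eq_image_phi:
  assumes "abelian_group A" and a: "a \<in> carrier A" and c: "c \<in> carrier A"
  shows "generate (add_monoid A) {a, c} = phi A a c ` carrier ZxZ"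
proof -
  interpret abelian_group A by fact
  interpret ZZ: ring ZxZ
    by (intro RDirProd_ring int.ring_axioms)
  interpret h: group_hom "add_monoid ZxZ" "add_monoid A" "phi A a c"
    by unfold_locales (rule phi_hom[OF assms])
  show ?thesis
  proof (rule sym, rule add.generateI)
    show "subgroup (phi A a c ` carrier ZxZ) (add_monoid A)"
      using h.img_is_subgroup by simp
    have "a = phi A a c (1, 0)" and "c = phi A a c (0, 1)"
      using a c by (simp_all add: phi_def add.int_pow_1 add.int_pow_eq_id)
    then show "{a, c} \<subseteq> phi A a c ` carrier ZxZ"
      by (auto simp: RDirProd_carrier)
  next
    fix K assume "subgroup K (add_monoid A)" and "{a, c} \<subseteq> K"
    then show "phi A a c ` carrier ZxZ \<subseteq> K"
      using add.subgroup_int_pow_closed[of K] subgroup.m_closed[of K "add_monoid A"]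
      by (auto simp: phi_def add_pow_def)
  qed
qed

lemma phi_RDirProd:
  assumes "ring R" and "ring S"
    and "a \<in> carrier R" and "c \<in> carrier R" and "b \<in> carrier S" and "d \<in> carrier S"
  shows "phi (RDirProd R S) (a, b) (c, d) = (\<lambda>p. (phi R a c p, phi S b d p))"
proof -
  interpret R: ring R by fact
  interpret S: ring S by fact
  interpret P: ring "RDirProd R S" by (rule RDirProd_ring[OF assms(1,2)])
  interpret p1: group_hom "add_monoid (RDirProd R S)" "add_monoid R" fst
    by unfold_locales (auto simp: hom_def RDirProd_carrier RDirProd_add)
  interpret p2: group_hom "add_monoid (RDirProd R S)" "add_monoid S" snd
    by unfold_locales (auto simp: hom_def RDirProd_carrier RDirProd_add)
  have pow: "[k] \<cdot>\<^bsub>RDirProd R S\<^esub> (x, y) = ([k] \<cdot>\<^bsub>R\<^esub> x, [k] \<cdot>\<^bsub>S\<^esub> y)"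
    if "x \<in> carrier R" "y \<in> carrier S" for x y and k :: int
    using p1.hom_int_pow[of "(x, y)" k] p2.hom_int_pow[of "(x, y)" k] that
    by (simp add: add_pow_def RDirProd_carrier prod_eq_iff)
  show ?thesis
    using assms(3-) by (auto simp: phi_def pow fun_eq_iff RDirProd_add)
qed

theorem theorem4p6:
  fixes n m :: nat and a b c d :: "int set"
  assumes "n > 0" and "m > 0"
    and "a \<in> carrier (ZFact (int n))" and "c \<in> carrier (ZFact (int n))"
    and "b \<in> carrier (ZFact (int m))" and "d \<in> carrier (ZFact (int m))"
  shows "ideal
           (generate (add_monoid (RDirProd (ZFact (int n)) (ZFact (int m)))) {(a, b), (c, d)})
           (RDirProd (ZFact (int n)) (ZFact (int m)))
         \<longleftrightarrow>
         a_kernel ZxZ (ZFact (int n)) (phi (ZFact (int n)) a c)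
           <+>\<^bsub>ZxZ\<^esub> a_kernel ZxZ (ZFact (int m)) (phi (ZFact (int m)) b d)
         = carrier ZxZ"
proof -
  let ?R = "ZFact (int n)" and ?S = "ZFact (int m)"
  let ?f = "phi ?R a c" and ?g = "phi ?S b d"
  interpret R: cring ?R by (rule ZFact_is_cring)
  interpret S: cring ?S by (rule ZFact_is_cring)
  interpret P: ring "RDirProd ?R ?S" by (rule RDirProd_ring) unfold_locales
  interpret ZZ: ring ZxZ
    by (intro RDirProd_ring int.ring_axioms)
  have "generate (add_monoid (RDirProd ?R ?S)) {(a, b), (c, d)}
      = phi (RDirProd ?R ?S) (a, b) (c, d) ` carrier ZxZ"
    using assms by (intro generate_pair_eq_image_phi P.is_abelian_group) (simp_all add: RDirProd_carrier)
  also have "\<dots> = (\<lambda>p. (?f p, ?g p)) ` carrier (add_monoid ZxZ)"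
    using assms by (simp add: phi_RDirProd R.ring_axioms S.ring_axioms RDirProd_carrier)
  finally have "ideal (generate (add_monoid (RDirProd ?R ?S)) {(a, b), (c, d)}) (RDirProd ?R ?S)
      \<longleftrightarrow> kernel (add_monoid ZxZ) (add_monoid ?R) ?f
          <#>\<^bsub>add_monoid ZxZ\<^esub> kernel (add_monoid ZxZ) (add_monoid ?S) ?g = carrier (add_monoid ZxZ)"
    using assms
    by (simp only:) (intro ideal_pair_image_iff ZZ.a_comm_group R.ring_axioms S.ring_axioms
        one_generated_ZFact phi_hom R.is_abelian_group S.is_abelian_group)
  then show ?thesis
    by (simp add: a_kernel_def set_add_def RDirProd_carrier)
qed

end
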